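(* Assume conditions (A1)–(A5) described in the context hold, that $\Psi\in\mathsf{LocSafe}$, and that $\mathsf{Update}=\bigvee_{f\in F}\mathsf{Update}_f$ where each $\mathsf{Update}_f$ has the form required in (A3). Assume the clauses in $\Psi$ and in $\mathsf{Update}_f$ are flat and linear for all $f\in F$, let $m$ be the maximal number of variables in a clause of $\Psi$, and assume that the only non-parametric function symbols which need to be eliminated are the primed symbols $\{f'\mid f\in F\}$. Consider the variant of Algorithm 2 described in the context, which performs symbol elimination with the refinement in which the parameter-only axioms are not instantiated. Then for every step $n$: (i) the clauses in the candidate invariant $I_n$ obtained at step $n$ are flat, and (ii) the number of universally quantified variables in every clause of $I_n$ is at most $m$.
   Context: Setting: $\Pi_0=(\Sigma_0,\mathsf{Pred})$ is the signature of a base theory $\mathcal{T}_0$. A transition constraint system $T=(\Sigma_S,\mathsf{Init},\mathsf{Update})$ with background theory $\mathcal{T}_S$ has $\Sigma_S=\Sigma_0\cup\Sigma_P\cup\Sigma$, where $\Sigma_P$ is a set of parametric function symbols and $\Sigma$ a set of non-parametric function symbols disjoint from $\Sigma_0\cup\Sigma_P$; $\mathsf{Init}$ is universal, and $\mathsf{Update}$ is over $\Sigma_S$ and primed copies $f'$ of updated symbols $f\in F\subseteq\Sigma$. For a formula $\phi$, $\phi'$ replaces each $f\in\Sigma$ by $f'$. $I$ is an inductive invariant if $\mathsf{Init}\models_{\mathcal{T}_S}I$ and $I\wedge\mathsf{Update}\models_{\mathcal{T}_S}I'$. $\Psi$ is a universal formula over $\Sigma_P$, a conjunction of clauses $\forall\overline{x}(C_i(\overline{x})\vee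 C_v(\overline{x},\overline{f}(\overline{x})))$; $\mathsf{LocSafe}$ is a given class of universal formulae over $\Sigma_S$. A set of clauses is flat if extension (non-base) function symbols are applied only to variables, and linear if each variable occurs in at most one term starting with an extension function and no such term contains a variable twice. An extension $\mathcal{T}_0\cup\mathcal{K}$ is local if for every finite set $G$ of ground clauses, $\mathcal{T}_0\cup\mathcal{K}\cup G$ is unsatisfiable iff $\mathcal{T}_0\cup\mathcal{K}[G]\cup G$ is, where $\mathcal{K}[G]$ consists of the instances of $\mathcal{K}$ whose extension terms are ground terms occurring in $\mathcal{K}$ or $G$. $(\mathsf{Comp}_f)$: every partial model whose base reduct is a total model of $\mathcal{T}_0$ and whose extension functions have finite domains of definition weakly embeds into a total model with the same universe. Assumptions: (A1) a chain of local extensions $\mathcal{T}_0\subseteq\dots\subseteq\mathcal{T}_S\cup\mathsf{Init}$ exists, each with all variables below an extension function; (A2) for each $\Psi\in\mathsf{LocSafe}$ such a chain $\mathcal{T}_0\subseteq\dots\subseteq\mathcal{T}_S\cup\Psi$ exists; (A3) $\mathsf{Update}_f=\{\forall\overline{x}(\phi^f_i(\overline{x})\to C^f_i(\overline{x},f'(\overline{x})))\mid i=1,\dots,n_f\}$ with $\phi_i\wedge\phi_j\models_{\mathcal{T}_S}\perp$ for $i\neq j$, $\mathcal{T}_S\models\bigvee_i\phi_i$, and each $C^f_i$ a conjunction of literals with $\mathcal{T}_S\models\forall\overline{x}(\phi_i\to\exists y\,C^f_i(\overline{x},y))$; (A4) ground satisfiability in $\mathcal{T}_0$ is decidable and $\mathcal{T}_0$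 allows quantifier elimination; (A5) all candidate invariants computed are in $\mathsf{LocSafe}$, and all local extensions for formulae in $\mathsf{LocSafe}$ satisfy $(\mathsf{Comp}_f)$. Algorithm 2: $I_1:=\Psi$; at step $n$, if $I_n$ is an inductive invariant return it; if $\mathsf{Init}\not\models_{\mathcal{T}_S}I_n$ return ``no universal inductive invariant over $\Sigma_P$ entails $\Psi$''; otherwise compute a universal formula $\Gamma_n$ over $\Sigma_P$ by symbol elimination and set $I_{n+1}:=I_n\wedge\Gamma_n$. In the variant considered, $\Gamma_n=\bigwedge_{f\in F}\Gamma^f_n$, where $\Gamma^f_n$ is obtained by applying symbol elimination only to $\mathsf{Update}_f\wedge G$, $G$ being the Skolemization of $\neg\Gamma'_{n-1}$ (with $\Gamma_0:=\Psi$): instantiate $\mathsf{Update}_f$ at the terms $f'(d)$ of $G$; replace each $f'(d)$ by a fresh constant and add instances of the congruence axioms for $f'$; replace terms $g(c)$, $g\in\Sigma_P$, by fresh constants; replace the constants standing for the $f'(d)$ by existentially quantified variables and eliminate them by quantifier elimination in $\mathcal{T}_0$; replace constants back by the terms $g(c)$; replace the Skolem constants by existentially quantified variables $\overline y$; output the negation $\forall\overline y\,\neg(\cdots)$ as a conjunction of universally quantified clauses. *)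

theory Defs
  imports Main "HOL-Library.Nat_Bijection"
begin

section \<open>Syntax\<close>

text \<open>A function or predicate symbol of a signature is a pair (name, arity).\<close>

type_synonym fsym = "nat \<times> nat"
type_synonym psym = "nat \<times> nat"

text \<open>Besides the signature symbols \<open>Fn g\<close> there are the primed copies \<open>Pr g\<close>, a supply \<open>Sk i\<close> of
  fresh (Skolem) constants, and for every term \<open>t\<close> a constant \<open>Nm t\<close> that serves as the name of \<open>t\<close>
  in purified formulae. Freshness of these constants holds by construction.\<close>

datatype trm = Var nat | App sym "trm list"
  and sym = Fn fsym | Pr fsym | Sk nat | Nm trm

fun arity :: "sym \<Rightarrow> nat" where
  "arity (Fn g) = snd g"
| "arity (Pr g) = snd g"
| "arity (Sk i) = 0"
| "arity (Nm t) = 0"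

datatype 't atm = Pred psym "'t list" | Eq 't 't

datatype 'a fm = TT | At 'a | Neg "'a fm" | And "'a fm" "'a fm" | Or "'a fm" "'a fm"
  | Ex nat "'a fm" | All nat "'a fm"

type_synonym form = "trm atm fm"

text \<open>A literal carries its sign. The variables of a clause are implicitly universally quantified, and
  a universal formula is represented by a finite set of clauses, read conjunctively.\<close>

type_synonym literal = "bool \<times> trm atm"
type_synonym clause = "literal list"

primrec var_list :: "trm \<Rightarrow> nat list" where
  "var_list (Var x) = [x]"
| "var_list (App f ts) = concat (map var_list ts)"

primrec subterms :: "trm \<Rightarrow> trm set" where
  "subterms (Var x) = {Var x}"
| "subterms (App f ts) = insert (App f ts) (\<Union> (set (map subterms ts)))"

primrec subst :: "(nat \<Rightarrow> trm) \<Rightarrow> trm \<Rightarrow> trm" where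
  "subst \<sigma> (Var x) = \<sigma> x"
| "subst \<sigma> (App f ts) = App f (map (subst \<sigma>) ts)"

definition vars :: "trm \<Rightarrow> nat set" where
  "vars t = set (var_list t)"

definition atm_vars :: "trm atm \<Rightarrow> nat set" where
  "atm_vars a = \<Union> (vars ` set_atm a)"

primrec fv :: "form \<Rightarrow> nat set" where
  "fv TT = {}"
| "fv (At a) = atm_vars a"
| "fv (Neg \<phi>) = fv \<phi>"
| "fv (And \<phi> \<psi>) = fv \<phi> \<union> fv \<psi>"
| "fv (Or \<phi> \<psi>) = fv \<phi> \<union> fv \<psi>"
| "fv (Ex x \<phi>) = fv \<phi> - {x}"
| "fv (All x \<phi>) = fv \<phi> - {x}"

primrec qfree :: "'a fm \<Rightarrow> bool" where
  "qfree TT = True"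
| "qfree (At a) = True"
| "qfree (Neg \<phi>) = qfree \<phi>"
| "qfree (And \<phi> \<psi>) = (qfree \<phi> \<and> qfree \<psi>)"
| "qfree (Or \<phi> \<psi>) = (qfree \<phi> \<and> qfree \<psi>)"
| "qfree (Ex x \<phi>) = False"
| "qfree (All x \<phi>) = False"

definition atm_subterms :: "trm atm \<Rightarrow> trm set" where
  "atm_subterms a = \<Union> (subterms ` set_atm a)"

definition cl_vars :: "clause \<Rightarrow> nat set" where
  "cl_vars C = \<Union> ((atm_vars \<circ> snd) ` set C)"

definition cl_subterms :: "clause \<Rightarrow> trm set" where
  "cl_subterms C = \<Union> ((atm_subterms \<circ> snd) ` set C)"

definition fm_consts :: "form \<Rightarrow> sym set" where
  "fm_consts \<phi> = {c. arity c = 0 \<and> App c [] \<in> \<Union> (atm_subterms ` set_fm \<phi>)}"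

definition map_cl :: "(trm \<Rightarrow> trm) \<Rightarrow> clause \<Rightarrow> clause" where
  "map_cl g = map (map_prod id (map_atm g))"

text \<open>Applied to quantifier-free formulae only, so no variable capture can occur.\<close>

definition map_trms :: "(trm \<Rightarrow> trm) \<Rightarrow> form \<Rightarrow> form" where
  "map_trms g = map_fm (map_atm g)"

definition conj_fm :: "'a fm list \<Rightarrow> 'a fm" where
  "conj_fm \<phi>s = foldr And \<phi>s TT"

definition disj_fm :: "'a fm list \<Rightarrow> 'a fm" where
  "disj_fm \<phi>s = foldr Or \<phi>s (Neg TT)"

definition imp_fm :: "'a fm \<Rightarrow> 'a fm \<Rightarrow> 'a fm" where
  "imp_fm \<phi> \<psi> = Or (Neg \<phi>) \<psi>"

fun lit_fm :: "literal \<Rightarrow> form" where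
  "lit_fm (b, a) = (if b then At a else Neg (At a))"

definition cl_fm :: "clause \<Rightarrow> form" where
  "cl_fm C = disj_fm (map lit_fm C)"

text \<open>\<open>cnf \<phi> True\<close> is a clause form of \<open>\<phi>\<close>, \<open>cnf \<phi> False\<close> one of its negation (for quantifier-free
  \<open>\<phi>\<close>).\<close>

primrec cnf :: "form \<Rightarrow> bool \<Rightarrow> clause list" where
  "cnf TT b = (if b then [] else [[]])"
| "cnf (At a) b = [[(b, a)]]"
| "cnf (Neg \<phi>) b = cnf \<phi> (\<not> b)"
| "cnf (And \<phi> \<psi>) b =
    (if b then cnf \<phi> b @ cnf \<psi> b else [C @ D. C \<leftarrow> cnf \<phi> b, D \<leftarrow> cnf \<psi> b])"
| "cnf (Or \<phi> \<psi>) b =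
    (if b then [C @ D. C \<leftarrow> cnf \<phi> b, D \<leftarrow> cnf \<psi> b] else cnf \<phi> b @ cnf \<psi> b)"
| "cnf (Ex x \<phi>) b = undefined"
| "cnf (All x \<phi>) b = undefined"

subsection \<open>Expressions over a signature\<close>

primrec over_trm :: "sym set \<Rightarrow> trm \<Rightarrow> bool" where
  "over_trm S (Var x) = True"
| "over_trm S (App f ts) = (f \<in> S \<and> length ts = arity f \<and> list_all (over_trm S) ts)"

fun over_atm :: "sym set \<Rightarrow> psym set \<Rightarrow> trm atm \<Rightarrow> bool" where
  "over_atm S P (Pred p ts) = (p \<in> P \<and> length ts = snd p \<and> list_all (over_trm S) ts)"
| "over_atm S P (Eq s t) = (over_trm S s \<and> over_trm S t)"

definition over_fm :: "sym set \<Rightarrow> psym set \<Rightarrow> form \<Rightarrow> bool" where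
  "over_fm S P \<phi> \<longleftrightarrow> (\<forall>a \<in> set_fm \<phi>. over_atm S P a)"

definition over_cl :: "sym set \<Rightarrow> psym set \<Rightarrow> clause \<Rightarrow> bool" where
  "over_cl S P C \<longleftrightarrow> (\<forall>L \<in> set C. over_atm S P (snd L))"

definition universal_over :: "sym set \<Rightarrow> psym set \<Rightarrow> clause set \<Rightarrow> bool" where
  "universal_over S P N \<longleftrightarrow> finite N \<and> (\<forall>C \<in> N. over_cl S P C)"

subsection \<open>Flat and linear clauses\<close>

text \<open>\<open>B\<close> is the set of base function symbols; all other function symbols are extension symbols.\<close>

definition ext_terms :: "sym set \<Rightarrow> clause \<Rightarrow> trm set" where
  "ext_terms B C = {t \<in> cl_subterms C. \<exists>f ts. t = App f ts \<and> f \<notin> B}"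

definition flat_cl :: "sym set \<Rightarrow> clause \<Rightarrow> bool" where
  "flat_cl B C \<longleftrightarrow> (\<forall>f ts. App f ts \<in> ext_terms B C \<longrightarrow> (\<forall>t \<in> set ts. \<exists>x. t = Var x))"

definition linear_cl :: "sym set \<Rightarrow> clause \<Rightarrow> bool" where
  "linear_cl B C \<longleftrightarrow>
    (\<forall>s \<in> ext_terms B C. \<forall>t \<in> ext_terms B C. vars s \<inter> vars t \<noteq> {} \<longrightarrow> s = t) \<and>
    (\<forall>t \<in> ext_terms B C. distinct (var_list t))"

definition max_vars :: "clause set \<Rightarrow> nat" where
  "max_vars N = Max (insert 0 ((\<lambda>C. card (cl_vars C)) ` N))"

section \<open>Semantics\<close>

text \<open>All signatures are countable, so by the downward Loewenheim-Skolem theorem satisfiability and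
  entailment are not affected by restricting universes to nonempty subsets of \<open>nat\<close>. A structure
  interprets all symbols at once.\<close>

record fo_struct =
  univ :: "nat set"
  fint :: "sym \<Rightarrow> nat list \<Rightarrow> nat"
  pint :: "psym \<Rightarrow> nat list \<Rightarrow> bool"

definition wf_struct :: "fo_struct \<Rightarrow> bool" where
  "wf_struct A \<longleftrightarrow> univ A \<noteq> {} \<and> (\<forall>f as. set as \<subseteq> univ A \<longrightarrow> fint A f as \<in> univ A)"

primrec tval :: "fo_struct \<Rightarrow> (nat \<Rightarrow> nat) \<Rightarrow> trm \<Rightarrow> nat" where
  "tval A v (Var x) = v x"
| "tval A v (App f ts) = fint A f (map (tval A v) ts)"

fun aval :: "fo_struct \<Rightarrow> (nat \<Rightarrow> nat) \<Rightarrow> trm atm \<Rightarrow> bool" where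
  "aval A v (Pred p ts) = pint A p (map (tval A v) ts)"
| "aval A v (Eq s t) = (tval A v s = tval A v t)"

primrec fval :: "fo_struct \<Rightarrow> (nat \<Rightarrow> nat) \<Rightarrow> form \<Rightarrow> bool" where
  "fval A v TT = True"
| "fval A v (At a) = aval A v a"
| "fval A v (Neg \<phi>) = (\<not> fval A v \<phi>)"
| "fval A v (And \<phi> \<psi>) = (fval A v \<phi> \<and> fval A v \<psi>)"
| "fval A v (Or \<phi> \<psi>) = (fval A v \<phi> \<or> fval A v \<psi>)"
| "fval A v (Ex x \<phi>) = (\<exists>a \<in> univ A. fval A (v(x := a)) \<phi>)"
| "fval A v (All x \<phi>) = (\<forall>a \<in> univ A. fval A (v(x := a)) \<phi>)"

definition valid_in :: "fo_struct \<Rightarrow> form \<Rightarrow> bool" where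
  "valid_in A \<phi> \<longleftrightarrow> (\<forall>v. range v \<subseteq> univ A \<longrightarrow> fval A v \<phi>)"

definition model :: "fo_struct \<Rightarrow> form set \<Rightarrow> bool" where
  "model A T \<longleftrightarrow> wf_struct A \<and> (\<forall>\<phi> \<in> T. valid_in A \<phi>)"

definition entails :: "form set \<Rightarrow> form \<Rightarrow> bool" where
  "entails T \<phi> \<longleftrightarrow> (\<forall>A. model A T \<longrightarrow> valid_in A \<phi>)"

definition satisfiable :: "form set \<Rightarrow> bool" where
  "satisfiable T \<longleftrightarrow> (\<exists>A. model A T)"

subsection \<open>Local theory extensions\<close>

definition ground :: "clause \<Rightarrow> bool" where
  "ground C \<longleftrightarrow> cl_vars C = {}"

text \<open>The instances of \<open>K\<close> whose extension terms (those starting with a symbol in \<open>E\<close>) are ground terms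
  occurring in \<open>K\<close> or \<open>G\<close>.\<close>

definition instances :: "sym set \<Rightarrow> clause set \<Rightarrow> clause set \<Rightarrow> clause set" where
  "instances E K G = {map_cl (subst \<sigma>) C | \<sigma> C. C \<in> K \<and>
    (\<forall>t \<in> ext_terms (- E) (map_cl (subst \<sigma>) C).
       vars t = {} \<and> t \<in> \<Union> (cl_subterms ` (K \<union> G)))}"

text \<open>\<open>T\<close> is the base theory, with function symbols \<open>B\<close>; \<open>E\<close> are the extension symbols.\<close>

definition local_ext ::
  "psym set \<Rightarrow> fsym set \<Rightarrow> form set \<Rightarrow> fsym set \<Rightarrow> clause set \<Rightarrow> bool" where
  "local_ext P B T E K \<longleftrightarrow>
    (\<forall>G. universal_over (Fn ` (B \<union> E) \<union> range Sk) P G \<and> (\<forall>C \<in> G. ground C) \<longrightarrow>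
      (\<not> satisfiable (T \<union> cl_fm ` K \<union> cl_fm ` G) \<longleftrightarrow>
       \<not> satisfiable (T \<union> cl_fm ` instances (Fn ` E) K G \<union> cl_fm ` G)))"

definition vars_below_ext :: "fsym set \<Rightarrow> clause set \<Rightarrow> bool" where
  "vars_below_ext E K \<longleftrightarrow>
    (\<forall>C \<in> K. \<forall>x \<in> cl_vars C. \<exists>t \<in> ext_terms (- (Fn ` E)) C. x \<in> vars t)"

text \<open>A chain of extensions of a base theory is given by the list of its steps \<open>(E, K)\<close>: new function
  symbols and extension clauses. The following requires \<open>Q\<close> of every single extension in the chain.\<close>

primrec chain_all ::
  "(fsym set \<Rightarrow> form set \<Rightarrow> fsym set \<Rightarrow> clause set \<Rightarrow> bool) \<Rightarrow> fsym set \<Rightarrow> form set \<Rightarrow>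
   (fsym set \<times> clause set) list \<Rightarrow> bool" where
  "chain_all Q B T [] = True"
| "chain_all Q B T (s # ss) =
    (Q B T (fst s) (snd s) \<and> chain_all Q (B \<union> fst s) (T \<union> cl_fm ` snd s) ss)"

definition local_chain ::
  "psym set \<Rightarrow> fsym set \<Rightarrow> form set \<Rightarrow> (fsym set \<times> clause set) list \<Rightarrow> bool" where
  "local_chain P B0 T0 = chain_all (\<lambda>B T E K.
     E \<inter> B = {} \<and> (\<forall>C \<in> K. over_cl (Fn ` (B \<union> E)) P C) \<and>
     vars_below_ext E K \<and> local_ext P B T E K) B0 T0"

subsection \<open>Completability of partial models\<close>

record part_struct =
  puniv :: "nat set"
  pfint :: "sym \<Rightarrow> nat list \<Rightarrow> nat option"
  ppint :: "psym \<Rightarrow> nat list \<Rightarrow> bool"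

primrec ptval :: "part_struct \<Rightarrow> (nat \<Rightarrow> nat) \<Rightarrow> trm \<Rightarrow> nat option" where
  "ptval A v (Var x) = Some (v x)"
| "ptval A v (App f ts) = (let us = map (ptval A v) ts in
     if None \<in> set us then None else pfint A f (map the us))"

text \<open>A literal holds weakly if some term in it is undefined, or if it is true in the usual sense.\<close>

fun weak_lit :: "part_struct \<Rightarrow> (nat \<Rightarrow> nat) \<Rightarrow> literal \<Rightarrow> bool" where
  "weak_lit A v (b, Eq s t) \<longleftrightarrow> ptval A v s = None \<or> ptval A v t = None \<or>
     (b \<longleftrightarrow> ptval A v s = ptval A v t)"
| "weak_lit A v (b, Pred p ts) \<longleftrightarrow> None \<in> set (map (ptval A v) ts) \<or>
     (b \<longleftrightarrow> ppint A p (map (the \<circ> ptval A v) ts))"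

text \<open>The base reduct of \<open>A\<close> is (the reduct of) a total model \<open>A0\<close> of \<open>T\<close>.\<close>

definition weak_partial_model ::
  "psym set \<Rightarrow> fsym set \<Rightarrow> form set \<Rightarrow> fsym set \<Rightarrow> clause set \<Rightarrow> part_struct \<Rightarrow> bool" where
  "weak_partial_model P B T E K A \<longleftrightarrow>
    (\<forall>f as b. set as \<subseteq> puniv A \<and> pfint A f as = Some b \<longrightarrow> b \<in> puniv A) \<and>
    (\<exists>A0. model A0 T \<and> univ A0 = puniv A \<and>
      (\<forall>f \<in> B. \<forall>as. set as \<subseteq> puniv A \<and> length as = snd f \<longrightarrow>
         pfint A (Fn f) as = Some (fint A0 (Fn f) as)) \<and>
      (\<forall>p \<in> P. \<forall>as. set as \<subseteq> puniv A \<and> length as = snd p \<longrightarrow>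
         ppint A p as = pint A0 p as)) \<and>
    (\<forall>C \<in> K. \<forall>v. range v \<subseteq> puniv A \<longrightarrow> (\<exists>L \<in> set C. weak_lit A v L))"

definition finite_ext_domains :: "fsym set \<Rightarrow> part_struct \<Rightarrow> bool" where
  "finite_ext_domains E A \<longleftrightarrow>
    (\<forall>f \<in> E. finite {as. set as \<subseteq> puniv A \<and> length as = snd f \<and> pfint A (Fn f) as \<noteq> None})"

definition weak_embedding ::
  "psym set \<Rightarrow> fsym set \<Rightarrow> part_struct \<Rightarrow> fo_struct \<Rightarrow> (nat \<Rightarrow> nat) \<Rightarrow> bool" where
  "weak_embedding P S A D h \<longleftrightarrow>
    h ` puniv A \<subseteq> univ D \<and> inj_on h (puniv A) \<and>
    (\<forall>f \<in> S. \<forall>as b. set as \<subseteq> puniv A \<and> length as = snd f \<and> pfint A (Fn f) as = Some b \<longrightarrow>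
       fint D (Fn f) (map h as) = h b) \<and>
    (\<forall>p \<in> P. \<forall>as. set as \<subseteq> puniv A \<and> length as = snd p \<longrightarrow>
       (ppint A p as \<longleftrightarrow> pint D p (map h as)))"

definition comp_f ::
  "psym set \<Rightarrow> fsym set \<Rightarrow> form set \<Rightarrow> fsym set \<Rightarrow> clause set \<Rightarrow> bool" where
  "comp_f P B T E K \<longleftrightarrow>
    (\<forall>A. weak_partial_model P B T E K A \<and> finite_ext_domains E A \<longrightarrow>
      (\<exists>D h. model D (T \<union> cl_fm ` K) \<and> univ D = puniv A \<and> weak_embedding P (B \<union> E) A D h))"

section \<open>Decidability of ground satisfiability and quantifier elimination\<close>

text \<open>The total recursive functions of \<open>n\<close> arguments.\<close>

inductive recursive :: "nat \<Rightarrow> (nat list \<Rightarrow> nat) \<Rightarrow> bool" where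
  zero: "recursive n (\<lambda>xs. 0)"
| succ: "recursive 1 (\<lambda>xs. Suc (hd xs))"
| proj: "i < n \<Longrightarrow> recursive n (\<lambda>xs. xs ! i)"
| compose: "recursive (length gs) f \<Longrightarrow> (\<forall>g \<in> set gs. recursive n g) \<Longrightarrow>
    recursive n (\<lambda>xs. f (map (\<lambda>g. g xs) gs))"
| prim_rec: "recursive n g \<Longrightarrow> recursive (Suc (Suc n)) h \<Longrightarrow>
    recursive (Suc n) (\<lambda>xs. rec_nat (g (tl xs)) (\<lambda>k r. h (k # r # tl xs)) (hd xs))"
| minimize: "recursive (Suc n) f \<Longrightarrow> (\<forall>xs. length xs = n \<longrightarrow> (\<exists>k. f (k # xs) = 0)) \<Longrightarrow>
    recursive n (\<lambda>xs. LEAST k. f (k # xs) = 0)"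

primrec enc_trm :: "trm \<Rightarrow> nat" and enc_sym :: "sym \<Rightarrow> nat" where
  "enc_trm (Var x) = prod_encode (0, x)"
| "enc_trm (App f ts) = prod_encode (1, prod_encode (enc_sym f, list_encode (map enc_trm ts)))"
| "enc_sym (Fn g) = prod_encode (0, prod_encode g)"
| "enc_sym (Pr g) = prod_encode (1, prod_encode g)"
| "enc_sym (Sk i) = prod_encode (2, i)"
| "enc_sym (Nm t) = prod_encode (3, enc_trm t)"

fun enc_atm :: "trm atm \<Rightarrow> nat" where
  "enc_atm (Pred p ts) =
    prod_encode (0, prod_encode (prod_encode p, list_encode (map enc_trm ts)))"
| "enc_atm (Eq s t) = prod_encode (1, prod_encode (enc_trm s, enc_trm t))"

definition enc_clauses :: "clause list \<Rightarrow> nat" where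
  "enc_clauses = list_encode \<circ> map (list_encode \<circ> map (\<lambda>(b, a). prod_encode (of_bool b, enc_atm a)))"

definition ground_sat_decidable :: "psym set \<Rightarrow> fsym set \<Rightarrow> form set \<Rightarrow> bool" where
  "ground_sat_decidable P B T \<longleftrightarrow>
    (\<exists>d. recursive 1 d \<and>
      (\<forall>Cs. universal_over (Fn ` B \<union> range Sk) P (set Cs) \<and> (\<forall>C \<in> set Cs. ground C) \<longrightarrow>
        d [enc_clauses Cs] = of_bool (satisfiable (T \<union> cl_fm ` set Cs))))"

text \<open>\<open>\<psi>\<close> is a result of quantifier elimination in \<open>T\<close> for \<open>\<phi>\<close>. Constants of \<open>\<phi>\<close> outside of the
  signature \<open>B\<close> of \<open>T\<close> are free parameters: a model of \<open>T\<close> interprets them arbitrarily.\<close>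

definition qe_result :: "psym set \<Rightarrow> fsym set \<Rightarrow> form set \<Rightarrow> form \<Rightarrow> form \<Rightarrow> bool" where
  "qe_result P B T \<phi> \<psi> \<longleftrightarrow>
    qfree \<psi> \<and> over_fm (Fn ` B \<union> fm_consts \<phi>) P \<psi> \<and> fv \<psi> \<subseteq> fv \<phi> \<and>
    (\<forall>A v. model A T \<and> range v \<subseteq> univ A \<longrightarrow> (fval A v \<phi> \<longleftrightarrow> fval A v \<psi>))"

definition allows_qe :: "psym set \<Rightarrow> fsym set \<Rightarrow> form set \<Rightarrow> bool" where
  "allows_qe P B T \<longleftrightarrow> (\<forall>\<phi>. over_fm (Fn ` B) P \<phi> \<longrightarrow> (\<exists>\<psi>. qe_result P B T \<phi> \<psi>))"

section \<open>Transition constraint systems\<close>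

text \<open>The background theory consists of the base theory \<open>base_ax\<close> and the clauses \<open>back_ax\<close>.
  For an updated symbol \<open>f\<close> of arity \<open>k\<close>, a pair \<open>(\<phi>, Ls)\<close> in \<open>upd f\<close> represents the rule with guard
  \<open>\<phi>(x)\<close> and effect \<open>Ls(x, y)\<close>, a conjunction of literals, where \<open>x\<close> is the tuple
  \<open>Var 0, ..., Var (k - 1)\<close> and \<open>y\<close> is \<open>Var k\<close>, which stands for the new value \<open>f'(x)\<close>.\<close>

record tsys =
  base_fun :: "fsym set"
  preds :: "psym set"
  base_ax :: "form set"
  back_ax :: "clause set"
  params :: "fsym set"
  nonparams :: "fsym set"
  updated :: "fsym set"
  upd :: "fsym \<Rightarrow> (form \<times> literal list) list"
  init :: "clause set"

definition base :: "tsys \<Rightarrow> sym set" where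
  "base S = Fn ` base_fun S"

definition param_sig :: "tsys \<Rightarrow> sym set" where
  "param_sig S = Fn ` (base_fun S \<union> params S)"

definition full_sig :: "tsys \<Rightarrow> sym set" where
  "full_sig S = Fn ` (base_fun S \<union> params S \<union> nonparams S)"

definition background :: "tsys \<Rightarrow> form set" where
  "background S = base_ax S \<union> cl_fm ` back_ax S"

text \<open>Updated symbols may also be parametric: candidate invariants are formulae over the parametric
  symbols, and they are affected by updates only if they contain updated symbols.\<close>

definition wf_tsys :: "tsys \<Rightarrow> bool" where
  "wf_tsys S \<longleftrightarrow>
    params S \<inter> base_fun S = {} \<and>
    nonparams S \<inter> (base_fun S \<union> params S) = {} \<and>
    finite (updated S) \<and> updated S \<subseteq> params S \<union> nonparams S \<and>
    (\<forall>\<phi> \<in> base_ax S. over_fm (base S) (preds S) \<phi> \<and> fv \<phi> = {}) \<and>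
    (\<forall>C \<in> back_ax S. over_cl (full_sig S) (preds S) C) \<and>
    universal_over (full_sig S) (preds S) (init S)"

subsection \<open>Updates\<close>

definition arg_vars :: "fsym \<Rightarrow> trm list" where
  "arg_vars f = map Var [0..<snd f]"

definition rule_fm :: "fsym \<Rightarrow> form \<times> literal list \<Rightarrow> form" where
  "rule_fm f r =
    map_trms (subst (\<lambda>i. if i < snd f then Var i else App (Pr f) (arg_vars f)))
      (imp_fm (fst r) (conj_fm (map lit_fm (snd r))))"

definition update_fms :: "tsys \<Rightarrow> fsym \<Rightarrow> form set" where
  "update_fms S f = rule_fm f ` set (upd S f)"

definition update_clauses :: "tsys \<Rightarrow> fsym \<Rightarrow> clause list" where
  "update_clauses S f = [C. r \<leftarrow> upd S f, C \<leftarrow> cnf (rule_fm f r) True]"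

text \<open>The guards are pairwise incompatible and exhaustive, and whenever a guard holds, some value
  satisfies its effect.\<close>

definition update_form :: "tsys \<Rightarrow> fsym \<Rightarrow> bool" where
  "update_form S f \<longleftrightarrow>
    (\<forall>(\<phi>, Ls) \<in> set (upd S f).
       qfree \<phi> \<and> over_fm (full_sig S) (preds S) \<phi> \<and> fv \<phi> \<subseteq> {..<snd f} \<and>
       over_cl (full_sig S) (preds S) Ls \<and> cl_vars Ls \<subseteq> {..snd f} \<and>
       entails (background S) (imp_fm \<phi> (Ex (snd f) (conj_fm (map lit_fm Ls))))) \<and>
    (\<forall>i < length (upd S f). \<forall>j < length (upd S f). i \<noteq> j \<longrightarrow>
       entails (background S) (Neg (And (fst (upd S f ! i)) (fst (upd S f ! j))))) \<and>
    entails (background S) (disj_fm (map fst (upd S f)))"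

text \<open>Guards and effects contain no symbols besides base and parametric ones, so that the primed
  symbols are the only ones to be eliminated.\<close>

definition only_primed_eliminated :: "tsys \<Rightarrow> bool" where
  "only_primed_eliminated S \<longleftrightarrow>
    (\<forall>f \<in> updated S. \<forall>(\<phi>, Ls) \<in> set (upd S f).
       over_fm (param_sig S) (preds S) \<phi> \<and> over_cl (param_sig S) (preds S) Ls)"

subsection \<open>Inductive invariants\<close>

fun prime_sym :: "fsym set \<Rightarrow> sym \<Rightarrow> sym" where
  "prime_sym F (Fn g) = (if g \<in> F then Pr g else Fn g)"
| "prime_sym F s = s"

primrec prime_trm :: "fsym set \<Rightarrow> trm \<Rightarrow> trm" where
  "prime_trm F (Var x) = Var x"
| "prime_trm F (App f ts) = App (prime_sym F f) (map (prime_trm F) ts)"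

definition prime_cl :: "tsys \<Rightarrow> clause \<Rightarrow> clause" where
  "prime_cl S = map_cl (prime_trm (updated S))"

definition init_entails :: "tsys \<Rightarrow> clause set \<Rightarrow> bool" where
  "init_entails S N \<longleftrightarrow> (\<forall>C \<in> N. entails (background S \<union> cl_fm ` init S) (cl_fm C))"

text \<open>The update is the disjunction of the updates of the single symbols.\<close>

definition preserved :: "tsys \<Rightarrow> clause set \<Rightarrow> bool" where
  "preserved S N \<longleftrightarrow>
    (\<forall>f \<in> updated S. \<forall>C \<in> N.
       entails (background S \<union> cl_fm ` N \<union> update_fms S f) (cl_fm (prime_cl S C)))"

definition inductive_invariant :: "tsys \<Rightarrow> clause set \<Rightarrow> bool" where
  "inductive_invariant S N \<longleftrightarrow> init_entails S N \<and> preserved S N"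

section \<open>Symbol elimination\<close>

text \<open>The conjunction of literals obtained by Skolemizing the negation of a universal clause.\<close>

definition skolem_neg :: "clause \<Rightarrow> literal list" where
  "skolem_neg C = map (map_prod Not (map_atm (subst (\<lambda>x. App (Sk x) [])))) C"

primrec primed_terms :: "fsym set \<Rightarrow> trm \<Rightarrow> trm list" where
  "primed_terms F (Var x) = []"
| "primed_terms F (App f ts) =
    (if f \<in> Pr ` F then [App f ts] else []) @ concat (map (primed_terms F) ts)"

fun atm_trms :: "trm atm \<Rightarrow> trm list" where
  "atm_trms (Pred p ts) = ts"
| "atm_trms (Eq s t) = [s, t]"

definition primed_terms_of :: "fsym set \<Rightarrow> literal list \<Rightarrow> trm list" where
  "primed_terms_of F G =
    remdups (concat (map (primed_terms F) (concat (map (atm_trms \<circ> snd) G))))"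

fun args_of :: "trm \<Rightarrow> trm list" where
  "args_of (Var x) = []"
| "args_of (App f ts) = ts"

definition starts_with :: "sym \<Rightarrow> trm \<Rightarrow> bool" where
  "starts_with f t \<longleftrightarrow> (\<exists>ts. t = App f ts)"

definition update_instances :: "tsys \<Rightarrow> fsym \<Rightarrow> trm list \<Rightarrow> form list" where
  "update_instances S f ps =
    [cl_fm (map_cl (subst (\<lambda>i. args_of p ! i)) C).
       p \<leftarrow> filter (starts_with (Pr f)) ps, C \<leftarrow> update_clauses S f]"

definition congruences :: "trm list \<Rightarrow> form list" where
  "congruences ps =
    [imp_fm (conj_fm (map (\<lambda>(a, b). At (Eq a b)) (zip (args_of p) (args_of q)))) (At (Eq p q)).
       p \<leftarrow> ps, q \<leftarrow> filter (\<lambda>q. \<exists>f. starts_with f p \<and> starts_with f q) ps]"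

text \<open>Every maximal subterm starting with a symbol in \<open>E\<close> is replaced by the constant naming it.\<close>

primrec purify :: "sym set \<Rightarrow> trm \<Rightarrow> trm" where
  "purify E (Var x) = Var x"
| "purify E (App f ts) = (if f \<in> E then App (Nm (App f ts)) [] else App f (map (purify E) ts))"

primrec replace_consts :: "(sym \<Rightarrow> trm option) \<Rightarrow> trm \<Rightarrow> trm" where
  "replace_consts \<rho> (Var x) = Var x"
| "replace_consts \<rho> (App f ts) =
    (case \<rho> f of Some t \<Rightarrow> t | None \<Rightarrow> App f (map (replace_consts \<rho>) ts))"

definition names_to_vars :: "trm list \<Rightarrow> sym \<Rightarrow> trm option" where
  "names_to_vars ps c = map_of (zip (map Nm ps) (map Var [0..<length ps])) c"

fun names_to_terms :: "sym \<Rightarrow> trm option" where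
  "names_to_terms (Nm t) = Some t"
| "names_to_terms _ = None"

fun skolems_to_vars :: "sym \<Rightarrow> trm option" where
  "skolems_to_vars (Sk i) = Some (Var i)"
| "skolems_to_vars _ = None"

text \<open>The purified conjunction of the update instances, the Skolemized negation \<open>G\<close> of a primed clause
  and the congruence axioms for the primed terms, with the constants naming primed terms replaced by
  existentially quantified variables. The axioms of the background theory are not instantiated.\<close>

definition elim_problem :: "tsys \<Rightarrow> fsym \<Rightarrow> clause \<Rightarrow> form" where
  "elim_problem S f C =
    (let G = skolem_neg (prime_cl S C);
         ps = primed_terms_of (updated S) G;
         \<phi> = conj_fm (map lit_fm G @ update_instances S f ps @ congruences ps);
         \<phi>0 = map_trms (purify (Pr ` updated S \<union> Fn ` params S)) \<phi>
     in foldr Ex [0..<length ps] (map_trms (replace_consts (names_to_vars ps)) \<phi>0))"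

text \<open>The Skolem constant for the variable \<open>x\<close> of \<open>C\<close> is turned back into \<open>x\<close>; negating the result and
  reading its variables as universally quantified gives the output.\<close>

definition elim_result :: "tsys \<Rightarrow> fsym \<Rightarrow> clause \<Rightarrow> clause set \<Rightarrow> bool" where
  "elim_result S f C N \<longleftrightarrow>
    (\<exists>\<psi>. qe_result (preds S) (base_fun S) (base_ax S) (elim_problem S f C) \<psi> \<and>
      N = set (cnf (Neg (map_trms (replace_consts skolems_to_vars)
                     (map_trms (replace_consts names_to_terms) \<psi>))) True))"

text \<open>The negation of a conjunction of universal clauses is a disjunction of existential formulae, one
  for each clause. Existential quantification distributes over it, and it becomes a conjunction when
  the result is negated; the disjuncts are processed one by one.\<close>

definition strengthening_for :: "tsys \<Rightarrow> fsym \<Rightarrow> clause set \<Rightarrow> clause set \<Rightarrow> bool" where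
  "strengthening_for S f N N' \<longleftrightarrow>
    (\<exists>R. (\<forall>C \<in> N. elim_result S f C (R C)) \<and> N' = (\<Union>C \<in> N. R C))"

definition strengthening :: "tsys \<Rightarrow> clause set \<Rightarrow> clause set \<Rightarrow> bool" where
  "strengthening S N N' \<longleftrightarrow>
    (\<exists>R. (\<forall>f \<in> updated S. strengthening_for S f N (R f)) \<and> N' = (\<Union>f \<in> updated S. R f))"

section \<open>Invariant strengthening\<close>

text \<open>A run that has reached step \<open>n\<close>: \<open>I k\<close> is the candidate invariant at step \<open>k\<close> and \<open>\<Gamma> k\<close> the
  formula computed there. The run passes from step \<open>k\<close> to the next one only if it returns nothing at
  step \<open>k\<close>. Every formula that is a correct result of quantifier elimination may be used.\<close>

definition strengthening_run ::
  "tsys \<Rightarrow> clause set \<Rightarrow> nat \<Rightarrow> (nat \<Rightarrow> clause set) \<Rightarrow> (nat \<Rightarrow> clause set) \<Rightarrow> bool" where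
  "strengthening_run S \<Psi> n I \<Gamma> \<longleftrightarrow>
    I 1 = \<Psi> \<and> \<Gamma> 0 = \<Psi> \<and>
    (\<forall>k. 1 \<le> k \<and> k < n \<longrightarrow>
      \<not> inductive_invariant S (I k) \<and> init_entails S (I k) \<and>
      strengthening S (\<Gamma> (k - 1)) (\<Gamma> k) \<and> I (Suc k) = I k \<union> \<Gamma> k)"

definition local_chain_to :: "tsys \<Rightarrow> clause set \<Rightarrow> (fsym set \<times> clause set) list \<Rightarrow> bool" where
  "local_chain_to S N steps \<longleftrightarrow>
    local_chain (preds S) (base_fun S) (base_ax S) steps \<and>
    \<Union> (snd ` set steps) = back_ax S \<union> N"

definition comp_chain :: "tsys \<Rightarrow> (fsym set \<times> clause set) list \<Rightarrow> bool" where
  "comp_chain S steps \<longleftrightarrow> chain_all (comp_f (preds S)) (base_fun S) (base_ax S) steps"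

end

theory Submission
  imports Defs
begin

text \<open>Purification turns a flat clause over variables in \<open>V\<close> into terms built with base symbols from
  Skolem constants for \<open>V\<close> and names of flat terms. The instances of the updates and of the congruence
  axioms add no further primed terms, and quantifier elimination leaves only base symbols
  and the free constants of its input. Undoing the purification therefore yields flat terms over
  variables in \<open>V\<close> again: no new variables arise.\<close>

section \<open>Terms over base symbols with prescribed leaves\<close>

text \<open>Leaves may be arbitrary terms, so one notion describes clauses before and after
  Skolemization, purification and their inverses: each stage changes only the leaf set.\<close>

inductive_set base_terms :: "sym set \<Rightarrow> trm set \<Rightarrow> trm set" for B L where
  leaf: "t \<in> L \<Longrightarrow> t \<in> base_terms B L"
| app: "f \<in> B \<Longrightarrow> length ts = arity f \<Longrightarrow> (\<And>t. t \<in> set ts \<Longrightarrow> t \<in> base_terms B L) \<Longrightarrow>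
    App f ts \<in> base_terms B L"

text \<open>The argument set is a parameter because arguments are variables in clauses and Skolem
  constants during symbol elimination.\<close>

definition flat_terms :: "sym set \<Rightarrow> trm set \<Rightarrow> trm set" where
  "flat_terms E A = {App g ts | g ts. g \<in> E \<and> length ts = arity g \<and> set ts \<subseteq> A}"

abbreviation sk :: "nat \<Rightarrow> trm" where
  "sk x \<equiv> App (Sk x) []"

abbreviation nm :: "trm \<Rightarrow> trm" where
  "nm t \<equiv> App (Nm t) []"

text \<open>Terms and symbols are mutually recursive through \<open>Nm\<close>. The trivial
  predicate on symbols gives an induction that treats names as atomic.\<close>

lemma trm_induct [case_names Var App]:
  assumes "\<And>x. P (Var x)" and "\<And>f ts. (\<And>t. t \<in> set ts \<Longrightarrow> P t) \<Longrightarrow> P (App f ts)"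
  shows "P t"
  by (rule trm.induct[of P "\<lambda>_. True"]) (use assms in auto)

lemma vars_simps [simp]: "vars (Var x) = {x}" "vars (App f ts) = \<Union> (vars ` set ts)"
  by (auto simp: vars_def)

text \<open>The replacements made during symbol elimination commute with base symbols, so it
  suffices to inspect their effect on the leaves.\<close>

lemma base_terms_map:
  assumes "t \<in> base_terms B L"
    and "\<And>f ts. f \<in> B \<Longrightarrow> h (App f ts) = App f (map h ts)"
    and "\<And>t. t \<in> L \<Longrightarrow> h t \<in> base_terms B L'"
  shows "h t \<in> base_terms B L'"
  using assms(1)
  by induction (auto simp: assms(2,3) intro!: base_terms.app)

lemma base_terms_mono:
  assumes "t \<in> base_terms B L" "L \<subseteq> L'"
  shows "t \<in> base_terms B L'"
  using base_terms_map[of t B L id L'] assms by (auto intro: base_terms.leaf)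

lemma base_terms_vars:
  assumes "t \<in> base_terms B L" "\<And>l. l \<in> L \<Longrightarrow> vars l \<subseteq> X"
  shows "vars t \<subseteq> X"
  using assms(1) by induction (use assms(2) in \<open>auto simp del: vars_simps(1)\<close>)

text \<open>A node above the leaves carries a base symbol, so a subterm with any other head lies
  inside a leaf.\<close>

lemma base_terms_subterms:
  assumes "t \<in> base_terms B L" "App f us \<in> subterms t" "f \<notin> B"
  shows "\<exists>l \<in> L. App f us \<in> subterms l"
  using assms by induction auto

text \<open>Flatness is required of the instance because update clauses already contain
  \<open>f'(x)\<close> in place of the new value. An argument whose instance is a variable is itself
  a variable, so below a symbol of \<open>E\<close> only the variables in \<open>M\<close> can
  occur.\<close>

lemma flat_over_in_base_terms:
  assumes "over_trm (B \<union> E) s"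
    and "\<And>f ts t. App f ts \<in> subterms (subst \<tau> s) \<Longrightarrow> f \<notin> B \<Longrightarrow> t \<in> set ts \<Longrightarrow> \<exists>x. t = Var x"
    and "\<And>x. x \<in> vars s \<Longrightarrow> \<tau> x \<in> M"
  shows "subst \<tau> s \<in> base_terms B (M \<union> flat_terms E (M \<inter> range Var))"
  using assms
proof (induction s rule: trm_induct)
  case (Var x)
  then show ?case by (auto intro: base_terms.leaf)
next
  case (App f ts)
  show ?case
  proof (cases "f \<in> B")
    case True
    have "subst \<tau> s \<in> base_terms B (M \<union> flat_terms E (M \<inter> range Var))" if "s \<in> set ts" for s
      using that App.prems(1)
      by (intro App.IH App.prems(2,3)) (auto simp: list_all_iff)
    with True App.prems(1) show ?thesis by (auto intro!: base_terms.app)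
  next
    case False
    have "subst \<tau> s \<in> M \<inter> range Var" if s: "s \<in> set ts" for s
    proof -
      have "\<exists>x. subst \<tau> s = Var x"
        by (rule App.prems(2)[of f "map (subst \<tau>) ts"]) (use False s in auto)
      then obtain x y where "s = Var y" "\<tau> y = Var x" by (cases s) auto
      with App.prems(3)[of y] s show ?thesis by force
    qed
    then have "subst \<tau> (App f ts) \<in> flat_terms E (M \<inter> range Var)"
      using App.prems(1) False by (auto simp: flat_terms_def)
    then show ?thesis by (auto intro: base_terms.leaf)
  qed
qed

text \<open>Meant for results of quantifier elimination, whose terms are ground here and whose
  non-base symbols are constants.\<close>

lemma over_trm_in_base_terms:
  assumes "over_trm (B \<union> K) t" "vars t = {}" "\<And>c. c \<in> K - B \<Longrightarrow> arity c = 0 \<and> App c [] \<in> L"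
  shows "t \<in> base_terms B L"
  using assms(1,2)
proof (induction t rule: trm_induct)
  case (App f ts)
  show ?case
  proof (cases "f \<in> B")
    case True
    with App show ?thesis by (auto simp: list_all_iff intro!: base_terms.app)
  next
    case False
    with App.prems assms(3)[of f] show ?thesis by (auto intro: base_terms.leaf)
  qed
qed simp

section \<open>Terms of clauses and formulae\<close>

definition cl_trms :: "clause \<Rightarrow> trm set" where
  "cl_trms C = \<Union> ((set_atm \<circ> snd) ` set C)"

text \<open>Boolean structure and binding are forgotten: flatness and the variables of the output
  clauses depend only on the terms in the atoms.\<close>

definition fm_trms :: "form \<Rightarrow> trm set" where
  "fm_trms \<phi> = \<Union> (set_atm ` set_fm \<phi>)"

lemma cl_vars_eq: "cl_vars C = \<Union> (vars ` cl_trms C)"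
  by (auto simp: cl_vars_def atm_vars_def cl_trms_def)

lemma cl_subterms_eq: "cl_subterms C = \<Union> (subterms ` cl_trms C)"
  by (auto simp: cl_subterms_def atm_subterms_def cl_trms_def)

lemma cl_trms_append [simp]: "cl_trms (C @ D) = cl_trms C \<union> cl_trms D"
  by (auto simp: cl_trms_def)

lemma cl_trms_map_cl [simp]: "cl_trms (map_cl h C) = h ` cl_trms C"
  by (force simp: cl_trms_def map_cl_def atm.set_map)

lemma fm_trms_simps [simp]:
  "fm_trms TT = {}" "fm_trms (At a) = set_atm a" "fm_trms (Neg \<phi>) = fm_trms \<phi>"
  "fm_trms (And \<phi> \<psi>) = fm_trms \<phi> \<union> fm_trms \<psi>" "fm_trms (Or \<phi> \<psi>) = fm_trms \<phi> \<union> fm_trms \<psi>"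
  "fm_trms (Ex x \<phi>) = fm_trms \<phi>" "fm_trms (imp_fm \<phi> \<psi>) = fm_trms \<phi> \<union> fm_trms \<psi>"
  by (auto simp: fm_trms_def imp_fm_def)

lemma fm_trms_map_trms [simp]: "fm_trms (map_trms h \<phi>) = h ` fm_trms \<phi>"
  by (auto simp: fm_trms_def map_trms_def fm.set_map atm.set_map)

lemma fm_trms_lit_fm [simp]: "fm_trms (lit_fm L) = set_atm (snd L)"
  by (cases L) auto

lemma fm_trms_conj_fm [simp]: "fm_trms (conj_fm \<phi>s) = \<Union> (fm_trms ` set \<phi>s)"
  by (induction \<phi>s) (auto simp: conj_fm_def)

lemma fm_trms_cl_fm [simp]: "fm_trms (cl_fm C) = cl_trms C"
  by (induction C) (auto simp: cl_fm_def disj_fm_def cl_trms_def)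

lemma fm_trms_foldr_Ex [simp]: "fm_trms (foldr Ex xs \<phi>) = fm_trms \<phi>"
  by (induction xs) auto

lemma fv_foldr_Ex [simp]: "fv (foldr Ex xs \<phi>) = fv \<phi> - set xs"
  by (induction xs) auto

lemma fv_subset: "fv \<phi> \<subseteq> \<Union> (vars ` fm_trms \<phi>)"
  by (induction \<phi>) (auto simp: atm_vars_def fm_trms_def)

lemma fv_qfree: "qfree \<phi> \<Longrightarrow> fv \<phi> = \<Union> (vars ` fm_trms \<phi>)"
  by (induction \<phi>) (auto simp: atm_vars_def)

lemma fm_consts_eq: "fm_consts \<phi> = {c. arity c = 0 \<and> App c [] \<in> \<Union> (subterms ` fm_trms \<phi>)}"
  by (auto simp: fm_consts_def fm_trms_def atm_subterms_def)

lemma qfree_map_trms [simp]: "qfree (map_trms h \<phi>) = qfree \<phi>"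
  by (induction \<phi>) (auto simp: map_trms_def)

lemma qfree_conj_lits: "qfree (conj_fm (map lit_fm Ls))"
  by (induction Ls) (auto simp: conj_fm_def)

text \<open>Clause forms regroup literals and flip signs but create no terms. Quantifiers, on which
  \<open>cnf\<close> is undefined, are excluded.\<close>

lemma cnf_trms: "qfree \<phi> \<Longrightarrow> C \<in> set (cnf \<phi> b) \<Longrightarrow> cl_trms C \<subseteq> fm_trms \<phi>"
proof (induction \<phi> arbitrary: b C)
  case (At a)
  then show ?case by (auto simp: cl_trms_def)
next
  case (And \<phi> \<psi>)
  then show ?case by (force split: if_splits)
next
  case (Or \<phi> \<psi>)
  then show ?case by (force split: if_splits)
qed (auto simp: cl_trms_def split: if_splits)

lemma over_atm_trms: "over_atm S P a \<Longrightarrow> t \<in> set_atm a \<Longrightarrow> over_trm S t"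
  by (cases a) (auto simp: list_all_iff)

lemma over_fm_trms: "over_fm S P \<phi> \<Longrightarrow> t \<in> fm_trms \<phi> \<Longrightarrow> over_trm S t"
  by (auto simp: over_fm_def fm_trms_def intro: over_atm_trms)

lemma over_cl_trms: "over_cl S P C \<Longrightarrow> t \<in> cl_trms C \<Longrightarrow> over_trm S t"
  by (auto simp: over_cl_def cl_trms_def intro: over_atm_trms)

lemma flat_cl_arg_var:
  assumes "flat_cl B C" "t \<in> cl_trms C" "App f ts \<in> subterms t" "f \<notin> B" "u \<in> set ts"
  shows "\<exists>x. u = Var x"
proof -
  have "App f ts \<in> ext_terms B C"
    using assms by (auto simp: ext_terms_def cl_subterms_eq)
  with assms show ?thesis unfolding flat_cl_def by blast
qed

section \<open>Flat clauses over the parametric symbols\<close>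

definition flat_leaves :: "tsys \<Rightarrow> trm set \<Rightarrow> trm set" where
  "flat_leaves S A = A \<union> flat_terms (Fn ` params S) A"

text \<open>This is the invariant carried along a run. \<open>V\<close> may be larger than the set
  of variables of \<open>C\<close>: elimination may drop variables, while \<open>V\<close> is passed
  on unchanged.\<close>

definition flat_over :: "tsys \<Rightarrow> nat set \<Rightarrow> clause \<Rightarrow> bool" where
  "flat_over S V C \<longleftrightarrow> cl_trms C \<subseteq> base_terms (base S) (flat_leaves S (Var ` V))"

lemma param_sig_eq: "param_sig S = base S \<union> Fn ` params S"
  by (auto simp: param_sig_def base_def)

lemma flat_over_vars:
  assumes "flat_over S V C"
  shows "cl_vars C \<subseteq> V"
proof -
  have "vars t \<subseteq> V" if "t \<in> cl_trms C" for t
    using assms that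
    by (intro base_terms_vars[of t "base S" "flat_leaves S (Var ` V)"])
      (fastforce simp: flat_over_def flat_leaves_def flat_terms_def)+
  then show ?thesis by (auto simp: cl_vars_eq)
qed

lemma flat_over_flat:
  assumes "flat_over S V C"
  shows "flat_cl (base S) C"
  unfolding flat_cl_def
proof (intro allI impI ballI)
  fix f ts u
  assume ext: "App f ts \<in> ext_terms (base S) C" and u: "u \<in> set ts"
  then obtain t where t: "t \<in> cl_trms C" "App f ts \<in> subterms t" "f \<notin> base S"
    by (auto simp: ext_terms_def cl_subterms_eq)
  then have "\<exists>l \<in> flat_leaves S (Var ` V). App f ts \<in> subterms l"
    using assms by (intro base_terms_subterms) (auto simp: flat_over_def)
  then show "\<exists>x. u = Var x"
    using u by (fastforce simp: flat_leaves_def flat_terms_def)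
qed

text \<open>Entry point of the invariant, used for the clauses of \<Psi>: with the identity
  substitution, flatness becomes a description by leaves.\<close>

lemma flat_overI:
  assumes "over_cl (param_sig S) P C" "flat_cl (base S) C"
  shows "flat_over S (cl_vars C) C"
  unfolding flat_over_def
proof
  fix t
  assume t: "t \<in> cl_trms C"
  have id: "subst Var t = t" for t
    by (induction t rule: trm_induct) (auto intro: map_idI)
  have "subst Var t \<in> base_terms (base S)
      (Var ` cl_vars C \<union> flat_terms (Fn ` params S) (Var ` cl_vars C \<inter> range Var))"
  proof (rule flat_over_in_base_terms)
    show "over_trm (base S \<union> Fn ` params S) t"
      using over_cl_trms[OF assms(1) t] by (simp add: param_sig_eq)
    show "\<exists>x. u = Var x" if "App f ts \<in> subterms (subst Var t)" "f \<notin> base S" "u \<in> set ts" for f ts u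
      using flat_cl_arg_var[OF assms(2) t] that by (simp add: id)
    show "Var x \<in> Var ` cl_vars C" if "x \<in> vars t" for x
      using t that by (auto simp: cl_vars_eq)
  qed
  moreover have "Var ` cl_vars C \<inter> range Var = Var ` cl_vars C" by auto
  ultimately show "t \<in> base_terms (base S) (flat_leaves S (Var ` cl_vars C))"
    by (simp add: id flat_leaves_def)
qed

section \<open>Symbol elimination preserves flatness and variables\<close>

lemma wf_tsys_disjoint:
  assumes "wf_tsys S"
  shows "params S \<inter> base_fun S = {}" "updated S \<inter> base_fun S = {}"
  using assms by (auto simp: wf_tsys_def)

section \<open>Terms of the update clauses\<close>

text \<open>Flatness keeps \<open>f'(x)\<close> from occurring below a parametric symbol, so it
  occurs only as a leaf under base symbols.\<close>

lemma update_clause_trms: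
  assumes f: "f \<in> updated S" and form: "update_form S f" and only: "only_primed_eliminated S"
    and C: "C \<in> set (update_clauses S f)" and flat: "flat_cl (base S) C"
  shows "cl_trms C \<subseteq> base_terms (base S)
    (flat_leaves S (Var ` {..<snd f}) \<union> {App (Pr f) (arg_vars f)})"
proof
  fix t
  assume t: "t \<in> cl_trms C"
  \<comment> \<open>\<open>?\<tau>\<close> is the substitution built into \<open>rule_fm\<close>,
    which turns the variable for the new value into \<open>f'(x)\<close>; \<open>?M\<close> contains
    its values.\<close>
  let ?\<tau> = "\<lambda>i. if i < snd f then Var i else App (Pr f) (arg_vars f)"
  let ?M = "Var ` {..<snd f} \<union> {App (Pr f) (arg_vars f)}"
  obtain \<phi> Ls where r: "(\<phi>, Ls) \<in> set (upd S f)" and C': "C \<in> set (cnf (rule_fm f (\<phi>, Ls)) True)"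
    using C by (auto simp: update_clauses_def)
  have "qfree \<phi>"
    using form r by (auto simp: update_form_def)
  have over: "over_fm (param_sig S) (preds S) \<phi>" "over_cl (param_sig S) (preds S) Ls"
    using only f r by (auto simp: only_primed_eliminated_def)
  have "qfree (rule_fm f (\<phi>, Ls))"
    using \<open>qfree \<phi>\<close> by (simp add: rule_fm_def imp_fm_def qfree_conj_lits)
  with C' t have "t \<in> fm_trms (rule_fm f (\<phi>, Ls))" using cnf_trms by blast
  then obtain s where s: "t = subst ?\<tau> s" "s \<in> fm_trms \<phi> \<or> s \<in> cl_trms Ls"
    by (auto simp: rule_fm_def cl_trms_def)
  have "subst ?\<tau> s \<in> base_terms (base S) (?M \<union> flat_terms (Fn ` params S) (?M \<inter> range Var))"
  proof (rule flat_over_in_base_terms)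
    show "over_trm (base S \<union> Fn ` params S) s"
      using s(2) over over_fm_trms over_cl_trms unfolding param_sig_eq by blast
    show "\<exists>x. u = Var x" if "App g ts \<in> subterms (subst ?\<tau> s)" "g \<notin> base S" "u \<in> set ts" for g ts u
      using flat_cl_arg_var[OF flat t] that by (simp add: s(1))
  qed auto
  \<comment> \<open>Intersecting with the variables discards \<open>f'(x)\<close> as a possible
    argument.\<close>
  moreover have "?M \<inter> range Var = Var ` {..<snd f}" by auto
  ultimately show "t \<in> base_terms (base S)
      (flat_leaves S (Var ` {..<snd f}) \<union> {App (Pr f) (arg_vars f)})"
    by (simp add: s(1) flat_leaves_def Un_ac)
qed

section \<open>The Skolemized negation and its primed terms\<close>

text \<open>Primed symbols occur only as heads of leaves, and the arguments of such leaves are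
  Skolem constants; hence primed terms are never nested.\<close>

lemma primed_terms_flat:
  assumes "t \<in> base_terms (Fn ` B) (sk ` V \<union> flat_terms (Fn ` P \<union> Pr ` F) (sk ` V))"
  shows "set (primed_terms F t) \<subseteq> flat_terms (Pr ` F) (sk ` V)"
proof -
  have args: "primed_terms F u = []" if "u \<in> sk ` V" for u
    using that by auto
  show ?thesis
    using assms
  proof induction
    case (leaf t)
    then show ?case
    proof
      assume "t \<in> flat_terms (Fn ` P \<union> Pr ` F) (sk ` V)"
      then obtain g ts where t: "t = App g ts" "g \<in> Fn ` P \<union> Pr ` F" "length ts = arity g"
          "set ts \<subseteq> sk ` V"
        by (auto simp: flat_terms_def)
      with args have "primed_terms F u = []" if "u \<in> set ts" for u
        using that by blast
      with t show ?thesis by (auto simp: flat_terms_def)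
    qed (auto simp: args)
  next
    case (app f ts)
    then show ?case by auto
  qed
qed

text \<open>A primed leaf is listed among the primed terms of \<open>t\<close> itself, so the primed
  leaves can be narrowed to those that actually occur.\<close>

lemma base_terms_primed_terms:
  assumes "t \<in> base_terms (Fn ` B) (sk ` V \<union> flat_terms (Fn ` P \<union> Pr ` F) (sk ` V))"
  shows "t \<in> base_terms (Fn ` B)
    (sk ` V \<union> flat_terms (Fn ` P) (sk ` V) \<union> set (primed_terms F t))"
  using assms
proof induction
  case (leaf t)
  then show ?case by (intro base_terms.leaf) (auto simp: flat_terms_def)
next
  case (app f ts)
  then show ?case
    by (intro base_terms.app) (auto intro: base_terms_mono)
qed

lemma atm_trms_set: "set (atm_trms a) = set_atm a"
  by (cases a) auto

lemma cl_trms_skolem_neg: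
  "cl_trms (skolem_neg (prime_cl S C)) =
    (subst (\<lambda>x. sk x) \<circ> prime_trm (updated S)) ` cl_trms C"
  by (force simp: cl_trms_def skolem_neg_def prime_cl_def map_cl_def atm.set_map)

text \<open>Updated symbols are not base symbols, so priming only renames heads of parametric
  leaves. Skolemization then turns the variables into constants.\<close>

lemma skolem_neg_trms:
  assumes S: "wf_tsys S" and C: "flat_over S V C"
  shows "cl_trms (skolem_neg (prime_cl S C)) \<subseteq> base_terms (base S)
    (sk ` V \<union> flat_terms (Fn ` params S \<union> Pr ` updated S) (sk ` V))"
  unfolding cl_trms_skolem_neg
proof safe
  let ?h = "subst (\<lambda>x. sk x) \<circ> prime_trm (updated S)"
  let ?L = "sk ` V \<union> flat_terms (Fn ` params S \<union> Pr ` updated S) (sk ` V)"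
  fix t
  assume "t \<in> cl_trms C"
  with C have "t \<in> base_terms (base S) (flat_leaves S (Var ` V))"
    by (auto simp: flat_over_def)
  then show "?h t \<in> base_terms (base S) ?L"
  proof (rule base_terms_map)
    show "?h (App f ts) = App f (map ?h ts)" if "f \<in> base S" for f ts
      using that wf_tsys_disjoint[OF S] by (auto simp: base_def)
    fix l
    assume "l \<in> flat_leaves S (Var ` V)"
    then have "?h l \<in> ?L"
      unfolding flat_leaves_def
    proof
      assume "l \<in> flat_terms (Fn ` params S) (Var ` V)"
      then obtain g ts where g: "l = App (Fn g) ts" "g \<in> params S" "length ts = snd g"
          "set ts \<subseteq> Var ` V"
        by (auto simp: flat_terms_def)
      then have "set (map ?h ts) \<subseteq> sk ` V" by (auto simp: subset_iff)
      with g show ?thesis by (auto simp: flat_terms_def)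
    qed auto
    then show "?h l \<in> base_terms (base S) ?L" by (rule base_terms.leaf)
  qed
qed

section \<open>Input and result of quantifier elimination\<close>

text \<open>Instantiation and congruence axioms produce no primed terms beyond \<open>ps\<close>.
  The names of these become the bound variables, so the formula is closed, and names remain only for
  flat parametric terms over Skolem constants.\<close>

lemma elim_problem_trms:
  assumes S: "wf_tsys S" and f: "f \<in> updated S" and C: "flat_over S V C"
    and upd: "\<And>D. D \<in> set (update_clauses S f) \<Longrightarrow> cl_trms D \<subseteq> base_terms (base S)
      (flat_leaves S (Var ` {..<snd f}) \<union> {App (Pr f) (arg_vars f)})"
  shows "\<exists>n. fm_trms (elim_problem S f C) \<subseteq> base_terms (base S)
      (sk ` V \<union> nm ` flat_terms (Fn ` params S) (sk ` V) \<union> Var ` {..<n}) \<and>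
    fv (elim_problem S f C) = {}"
proof -
  define G where "G = skolem_neg (prime_cl S C)"
  define ps where "ps = primed_terms_of (updated S) G"
  define \<phi> where "\<phi> = conj_fm (map lit_fm G @ update_instances S f ps @ congruences ps)"
  \<comment> \<open>\<open>?L\<close> collects the leaves before and \<open>?L'\<close> those after
    \<open>?h\<close>, which purifies and then turns the names of primed terms into
    variables.\<close>
  let ?L = "flat_leaves S (sk ` V) \<union> set ps"
  let ?E = "Pr ` updated S \<union> Fn ` params S"
  let ?h = "replace_consts (names_to_vars ps) \<circ> purify ?E"
  let ?L' = "sk ` V \<union> nm ` flat_terms (Fn ` params S) (sk ` V) \<union> Var ` {..<length ps}"
  have G: "t \<in> base_terms (base S)
      (sk ` V \<union> flat_terms (Fn ` params S \<union> Pr ` updated S) (sk ` V))" if "t \<in> cl_trms G" for t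
    using skolem_neg_trms[OF S C] that unfolding G_def by blast
  have set_ps: "set ps = (\<Union>t \<in> cl_trms G. set (primed_terms (updated S) t))"
    by (auto simp: ps_def primed_terms_of_def cl_trms_def atm_trms_set)
  have ps: "set ps \<subseteq> flat_terms (Pr ` updated S) (sk ` V)"
    using primed_terms_flat G unfolding set_ps base_def by blast
  have "fm_trms \<phi> \<subseteq> base_terms (base S) ?L"
  proof
    fix t
    assume "t \<in> fm_trms \<phi>"
    then consider "t \<in> cl_trms G"
      | \<psi> where "\<psi> \<in> set (update_instances S f ps)" "t \<in> fm_trms \<psi>"
      | \<psi> where "\<psi> \<in> set (congruences ps)" "t \<in> fm_trms \<psi>"
      by (auto simp: \<phi>_def cl_trms_def)
    then show "t \<in> base_terms (base S) ?L"
    proof cases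
      case 1
      show ?thesis
        by (rule base_terms_mono[OF base_terms_primed_terms[OF G[OF 1, unfolded base_def],
              folded base_def]]) (use 1 in \<open>auto simp: set_ps flat_leaves_def\<close>)
    next
      case 2
      then obtain p D where p: "p \<in> set ps" "starts_with (Pr f) p"
        and D: "D \<in> set (update_clauses S f)"
        and t: "t \<in> subst (\<lambda>i. args_of p ! i) ` cl_trms D"
        by (auto simp: update_instances_def)
      obtain ts where ts: "p = App (Pr f) ts" "length ts = snd f" "set ts \<subseteq> sk ` V"
        using p ps by (auto simp: starts_with_def flat_terms_def)
      let ?s = "subst (\<lambda>i. ts ! i)"
      obtain u where u: "u \<in> cl_trms D" "t = ?s u" using t ts by auto
      have "u \<in> base_terms (base S)
          (flat_leaves S (Var ` {..<snd f}) \<union> {App (Pr f) (arg_vars f)})"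
        using upd[OF D] u by blast
      then have "?s u \<in> base_terms (base S) ?L"
      proof (rule base_terms_map)
        fix l
        assume l: "l \<in> flat_leaves S (Var ` {..<snd f}) \<union> {App (Pr f) (arg_vars f)}"
        have A: "?s v \<in> sk ` V" if "v \<in> Var ` {..<snd f}" for v
          using that ts by (auto simp: subset_iff)
        \<comment> \<open>The instance at \<open>p\<close> sends the argument tuple to the arguments
          of \<open>p\<close>; thus \<open>f'(x)\<close> becomes \<open>p\<close>, which already
          belongs to \<open>ps\<close>.\<close>
        have "map ?s (arg_vars f) = ts"
          using ts by (auto simp: arg_vars_def intro: nth_equalityI)
        then have *: "?s (App (Pr f) (arg_vars f)) \<in> set ps" using p ts by simp
        have **: "?s l \<in> flat_leaves S (sk ` V)" if "l \<in> flat_leaves S (Var ` {..<snd f})"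
          using that unfolding flat_leaves_def
        proof
          assume "l \<in> flat_terms (Fn ` params S) (Var ` {..<snd f})"
          then obtain g us where us: "l = App g us" "g \<in> Fn ` params S" "length us = arity g"
              "set us \<subseteq> Var ` {..<snd f}"
            by (auto simp: flat_terms_def)
          then have "set (map ?s us) \<subseteq> sk ` V" using A unfolding set_map by blast
          with us show "?s l \<in> sk ` V \<union> flat_terms (Fn ` params S) (sk ` V)"
            by (simp add: flat_terms_def)
        qed (use A in blast)
        from l * ** have "?s l \<in> ?L" by blast
        then show "?s l \<in> base_terms (base S) ?L" by (rule base_terms.leaf)
      qed simp
      with u show ?thesis by simp
    next
      case 3
      then obtain p q where pq: "p \<in> set ps" "q \<in> set ps"
        and "\<psi> = imp_fm (conj_fm (map (\<lambda>(a, b). At (Eq a b)) (zip (args_of p) (args_of q))))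
          (At (Eq p q))"
        by (auto simp: congruences_def)
      with 3 have t: "t \<in> set (args_of p) \<union> set (args_of q) \<union> {p, q}"
        by (auto dest: set_zip_leftD set_zip_rightD)
      \<comment> \<open>A congruence axiom contains only two primed terms and their arguments, which
        are Skolem constants and so already leaves.\<close>
      have "set (args_of r) \<subseteq> sk ` V" if "r \<in> set ps" for r
        using that ps by (force simp: flat_terms_def)
      with pq t show ?thesis by (auto simp: flat_leaves_def intro!: base_terms.leaf)
    qed
  qed
  moreover have "?h t \<in> base_terms (base S) ?L'" if "t \<in> base_terms (base S) ?L" for t
    using that
  proof (rule base_terms_map)
    show "?h (App g ts) = App g (map ?h ts)" if "g \<in> base S" for g ts
      using that wf_tsys_disjoint[OF S]
      by (auto simp: base_def names_to_vars_def split: option.splits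
          dest!: map_of_SomeD set_zip_leftD)
    fix l
    assume "l \<in> ?L"
    then consider "l \<in> sk ` V" | "l \<in> flat_terms (Fn ` params S) (sk ` V)" | "l \<in> set ps"
      by (auto simp: flat_leaves_def)
    then have "?h l \<in> ?L'"
    proof cases
      case 1
      then show ?thesis
        by (auto simp: names_to_vars_def split: option.splits dest!: map_of_SomeD set_zip_leftD)
    next
      case 2
      \<comment> \<open>The head of a parametric term is unprimed, so its name differs from all
        names of \<open>ps\<close> and survives as a constant.\<close>
      then have "Nm l \<notin> set (map Nm ps)" and pl: "purify ?E l = nm l"
        using ps by (auto simp: flat_terms_def)
      then have "names_to_vars ps (Nm l) = None"
        by (auto simp: names_to_vars_def map_of_zip_is_None)
      with 2 pl show ?thesis by auto
    next
      case 3
      then have pl: "purify ?E l = nm l"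
        using ps by (auto simp: flat_terms_def)
      obtain v where v: "names_to_vars ps (Nm l) = Some v"
        using 3 map_of_zip_is_None[of "map Nm ps" "map Var [0..<length ps]" "Nm l"]
        by (cases "names_to_vars ps (Nm l)") (auto simp: names_to_vars_def)
      then have "v \<in> Var ` {..<length ps}"
        by (auto simp: names_to_vars_def dest!: map_of_SomeD set_zip_rightD)
      with v pl show ?thesis by auto
    qed
    then show "?h l \<in> base_terms (base S) ?L'" by (rule base_terms.leaf)
  qed
  moreover have elim: "elim_problem S f C = foldr Ex [0..<length ps]
      (map_trms (replace_consts (names_to_vars ps)) (map_trms (purify ?E) \<phi>))"
    by (simp add: elim_problem_def Let_def G_def ps_def \<phi>_def)
  ultimately have trms: "fm_trms (elim_problem S f C) \<subseteq> base_terms (base S) ?L'"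
    by (auto simp: image_image)
  \<comment> \<open>Skolem constants and names contain no variables, so the only variables are those
    bound by the quantifier prefix.\<close>
  have "vars t \<subseteq> {..<length ps}" if "t \<in> fm_trms (elim_problem S f C)" for t
    by (rule base_terms_vars[OF subsetD[OF trms that]]) auto
  then have "fv (elim_problem S f C) = {}"
    using fv_subset[of "map_trms (replace_consts (names_to_vars ps)) (map_trms (purify ?E) \<phi>)"]
    unfolding elim by fastforce
  with trms show ?thesis by blast
qed

text \<open>The result of elimination has no free variables, and its non-base constants come from
  the input. Restoring named terms and then variables gives leaves over the same
  \<open>V\<close>.\<close>

lemma elim_result_flat_over:
  assumes S: "wf_tsys S" and f: "f \<in> updated S" and C: "flat_over S V C"
    and upd: "\<And>D. D \<in> set (update_clauses S f) \<Longrightarrow> cl_trms D \<subseteq> base_terms (base S)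
      (flat_leaves S (Var ` {..<snd f}) \<union> {App (Pr f) (arg_vars f)})"
    and N: "elim_result S f C N" "D \<in> N"
  shows "flat_over S V D"
proof -
  let ?Q = "elim_problem S f C"
  let ?L = "sk ` V \<union> nm ` flat_terms (Fn ` params S) (sk ` V)"
  let ?h = "replace_consts skolems_to_vars \<circ> replace_consts names_to_terms"
  obtain n where Q: "fm_trms ?Q \<subseteq> base_terms (base S) (?L \<union> Var ` {..<n})" "fv ?Q = {}"
    using elim_problem_trms[OF S f C upd] by blast
  obtain \<psi> where qe: "qe_result (preds S) (base_fun S) (base_ax S) ?Q \<psi>"
    and D: "D \<in> set (cnf (Neg (map_trms (replace_consts skolems_to_vars)
                     (map_trms (replace_consts names_to_terms) \<psi>))) True)"
    using N by (auto simp: elim_result_def)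
  have \<psi>: "qfree \<psi>" "over_fm (base S \<union> fm_consts ?Q) (preds S) \<psi>" "fv \<psi> = {}"
    using qe Q(2) by (auto simp: qe_result_def base_def)
  \<comment> \<open>Such a constant lies inside a leaf. Each leaf in question is itself a constant,
    since the term stored in a name is not a subterm of it.\<close>
  have const_leaf: "arity c = 0 \<and> App c [] \<in> ?L" if c: "c \<in> fm_consts ?Q - base S" for c
  proof -
    obtain t where t: "t \<in> fm_trms ?Q" "App c [] \<in> subterms t"
      using c by (auto simp: fm_consts_eq)
    then have "\<exists>l \<in> ?L \<union> Var ` {..<n}. App c [] \<in> subterms l"
      using c Q(1) by (intro base_terms_subterms) auto
    with c show ?thesis by (auto simp: fm_consts_eq)
  qed
  have "?h t \<in> base_terms (base S) (flat_leaves S (Var ` V))" if t: "t \<in> fm_trms \<psi>" for t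
  proof -
    have "t \<in> base_terms (base S) ?L"
      \<comment> \<open>For the quantifier-free \<psi>, having no free variables means that all its
        terms are ground.\<close>
      using over_fm_trms[OF \<psi>(2) t] const_leaf t \<psi>(3) fv_qfree[OF \<psi>(1)]
      by (intro over_trm_in_base_terms) auto
    then show ?thesis
    proof (rule base_terms_map)
      show "?h (App g ts) = App g (map ?h ts)" if "g \<in> base S" for g ts
        using that by (auto simp: base_def)
      fix l
      assume "l \<in> ?L"
      then have "?h l \<in> flat_leaves S (Var ` V)"
      proof
        \<comment> \<open>Names are expanded first, so the second replacement also reaches the
          Skolem constants inside the restored terms.\<close>
        assume "l \<in> nm ` flat_terms (Fn ` params S) (sk ` V)"
        then obtain g ts where "l = nm (App (Fn g) ts)" "g \<in> params S" "length ts = snd g"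
            "set ts \<subseteq> sk ` V"
          by (auto simp: flat_terms_def)
        then show ?thesis by (fastforce simp: flat_leaves_def flat_terms_def)
      qed (auto simp: flat_leaves_def)
      then show "?h l \<in> base_terms (base S) (flat_leaves S (Var ` V))" by (rule base_terms.leaf)
    qed
  qed
  moreover have "cl_trms D \<subseteq> ?h ` fm_trms \<psi>"
    using cnf_trms[OF _ D] \<psi>(1) by (simp add: image_image)
  ultimately show ?thesis by (auto simp: flat_over_def)
qed

section \<open>Induction along a run\<close>

theorem theorem12:
  fixes S :: tsys
    and LocSafe :: "clause set set"
    and chain :: "clause set \<Rightarrow> (fsym set \<times> clause set) list"
    and \<Psi> :: "clause set"
    and steps m :: nat
    and I \<Gamma> :: "nat \<Rightarrow> clause set"
  assumes system: "wf_tsys S"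
    and LocSafe: "\<And>N. N \<in> LocSafe \<Longrightarrow> universal_over (full_sig S) (preds S) N"
    and A1: "\<exists>ch. local_chain_to S (init S) ch"
    and A2: "\<And>N. N \<in> LocSafe \<Longrightarrow> local_chain_to S N (chain N)"
    and A3: "\<And>f. f \<in> updated S \<Longrightarrow> update_form S f"
    and A4: "ground_sat_decidable (preds S) (base_fun S) (base_ax S)"
            "allows_qe (preds S) (base_fun S) (base_ax S)"
    and run: "strengthening_run S \<Psi> steps I \<Gamma>"
    and A5: "\<And>n. 1 \<le> n \<Longrightarrow> n \<le> steps \<Longrightarrow> I n \<in> LocSafe"
            "\<And>N. N \<in> LocSafe \<Longrightarrow> comp_chain S (chain N)"
    and Psi: "universal_over (param_sig S) (preds S) \<Psi>" "\<Psi> \<in> LocSafe"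
    and flat_linear_Psi: "\<And>C. C \<in> \<Psi> \<Longrightarrow> flat_cl (base S) C \<and> linear_cl (base S) C"
    and flat_linear_update: "\<And>f C. f \<in> updated S \<Longrightarrow> C \<in> set (update_clauses S f) \<Longrightarrow>
            flat_cl (base S) C \<and> linear_cl (base S) C"
    and only_primed: "only_primed_eliminated S"
    and m: "m = max_vars \<Psi>"
  shows "\<forall>n. 1 \<le> n \<and> n \<le> steps \<longrightarrow>
    (\<forall>C \<in> I n. flat_cl (base S) C \<and> card (cl_vars C) \<le> m)"
proof -
  \<comment> \<open>Bounding \<open>V\<close> instead of the variables of \<open>C\<close> makes the
    property inherited: an output clause can reuse the \<open>V\<close> of the clause it was
    computed from.\<close>
  define good where "good C \<longleftrightarrow> (\<exists>V. finite V \<and> card V \<le> m \<and> flat_over S V C)" for C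
  have upd: "cl_trms D \<subseteq> base_terms (base S)
      (flat_leaves S (Var ` {..<snd f}) \<union> {App (Pr f) (arg_vars f)})"
    if "f \<in> updated S" "D \<in> set (update_clauses S f)" for f D
    using update_clause_trms[OF that(1) A3[OF that(1)] only_primed that(2)]
      flat_linear_update[OF that] by blast
  have good_Psi: "good C" if C: "C \<in> \<Psi>" for C
  proof -
    have "finite \<Psi>" "over_cl (param_sig S) (preds S) C"
      using Psi(1) C by (auto simp: universal_over_def)
    then have "card (cl_vars C) \<le> m" "flat_over S (cl_vars C) C"
      using C flat_linear_Psi[OF C] by (auto simp: m max_vars_def intro: flat_overI)
    \<comment> \<open>Reading \<open>set_atm\<close> as the set of the list \<open>atm_trms\<close>
      makes finiteness evident.\<close>
    moreover have "finite (cl_vars C)"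
      by (auto simp: cl_vars_def atm_vars_def vars_def atm_trms_set[symmetric])
    ultimately show ?thesis unfolding good_def by blast
  qed
  \<comment> \<open>Each clause of \<open>N'\<close> stems from one updated symbol and one clause of
    \<open>N\<close>, whose \<open>V\<close> is kept.\<close>
  have good_step: "\<forall>C \<in> N'. good C" if "strengthening S N N'" "\<forall>C \<in> N. good C" for N N'
    using that elim_result_flat_over[OF system _ _ upd]
    unfolding strengthening_def strengthening_for_def good_def by (metis UN_E)
  have run_step: "strengthening S (\<Gamma> (k - 1)) (\<Gamma> k)" "I (Suc k) = I k \<union> \<Gamma> k"
    if "1 \<le> k" "k < steps" for k
    using run that by (auto simp: strengthening_run_def)
  have start: "I 1 = \<Psi>" "\<Gamma> 0 = \<Psi>"
    using run by (auto simp: strengthening_run_def)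
  \<comment> \<open>The run determines \<Gamma> at a positive \<open>k\<close> only when it passes
    beyond step \<open>k\<close>, whereas at 0 it is always \<Psi>.\<close>
  have good_Gamma: "\<forall>C \<in> \<Gamma> k. good C" if "k < steps \<or> k = 0" for k
    using that
  proof (induction k)
    case 0
    then show ?case using good_Psi start by simp
  next
    case (Suc k)
    then show ?case using run_step(1)[of "Suc k"] good_step by auto
  qed
  \<comment> \<open>Each candidate is \<Psi> together with the strengthenings of earlier steps, so
    the property is collected clause by clause from step 1 on.\<close>
  have good_I: "\<forall>C \<in> I n. good C" if "1 \<le> n" "n \<le> steps" for n
    using that
  proof (induction n rule: dec_induct)
    case base
    then show ?case using good_Psi start by simp
  next
    case (step k)
    then show ?case using run_step(2)[of k] good_Gamma[of k] by auto
  qed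
  have "flat_cl (base S) C \<and> card (cl_vars C) \<le> m" if "good C" for C
    using that flat_over_flat flat_over_vars card_mono le_trans unfolding good_def by metis
  with good_I show ?thesis by blast
qed

end
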